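(* Let $n\ge 2$ and $p$ be $0$ or a prime. The $\binom{2n}{4}$ Plücker relations $X_{ij}X_{kl}-X_{ik}X_{jl}+X_{il}X_{jk}$ for $i<j<k<l$ in $[2n]$, together with the symplectic relation $X_{1\bar1}+X_{2\bar2}+\dots+X_{n\bar n}$, form a tropical basis of the ideal $S_{2,2n}(\mathbb{K})$; that is, $\mathrm{SpDr}(2,2n)=\mathrm{TSpGr}_p(2,2n)$. In particular, $\mathrm{TSpGr}_p(2,2n)$ does not depend on $p$.
   Context: $[2n]=\{1,\dots,n,\bar1,\dots,\bar n\}$ ordered $1<\dots<n<\bar1<\dots<\bar n$. $\mathbb{T}=\mathbb{R}\cup\{\infty\}$, $\mathbb{TP}^{N-1}=(\mathbb{T}^N\setminus\{(\infty,\dots,\infty)\})/\mathbb{R}(1,\dots,1)$. $\mathbb{K}$ is an algebraically closed field of characteristic $p$ with non-Archimedean valuation $\mathrm{val}:\mathbb{K}\to\mathbb{T}$. The standard symplectic form $\omega$ on $\mathbb{K}^{2n}$ has $\omega(e_i,e_{\bar i})=1=-\omega(e_{\bar i},e_i)$ for $i\in[n]$ and all other pairings of basis vectors $0$; $S_{2,2n}(\mathbb{K})\subseteq\mathbb{K}[X_J:J\in\binom{[2n]}{2}]$ is the ideal of polynomials vanishing on Plücker vectors of all $2$-dimensional $\omega$-isotropic subspaces of $\mathbb{K}^{2n}$. For a polynomial $f=\sum_uc_uX^u$, $\mathrm{trop}(V(f))$ is the set of $w$ with $\min_u(\mathrm{val}(c_u)+u\cdot w)$ attained at least twice. $\mathrm{TSpGr}_p(2,2n)$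 is the set of $w\in\mathbb{TP}^{\binom{2n}{2}-1}$ in $\mathrm{trop}(V(f))$ for all $f\in S_{2,2n}(\mathbb{K})$. A finite set of polynomials is a tropical basis of the ideal it generates if the intersection of the tropical hypersurfaces of its members equals the tropical variety of the ideal. $\mathrm{SpDr}(2,2n)$ is the set of $\mu\in\mathbb{TP}^{\binom{2n}{2}-1}$ such that for all $i<j<k<l$ the minimum of $\mu_{ij}+\mu_{kl},\mu_{ik}+\mu_{jl},\mu_{il}+\mu_{jk}$ is attained at least twice, and the minimum of $\mu_{1\bar1},\dots,\mu_{n\bar n}$ is attained at least twice (or is $\infty$). *)

theory Defs
  imports Complex_Main "HOL-Library.Extended_Real" "HOL-Library.Poly_Mapping"
          "HOL-Computational_Algebra.Polynomial"
begin

text \<open>Ground set [2n] is encoded as {1..2n} (nat), where the barred element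
  bar i is encoded as n + i; the order 1<..<n<bar 1<..<bar n is the usual order
  on nat. Plucker variables X_J for J a 2-subset {i<j} are indexed by (i,j).\<close>

definition bar :: "nat \<Rightarrow> nat \<Rightarrow> nat" where
  "bar n i = n + i"

definition pidx :: "nat \<Rightarrow> (nat \<times> nat) set" where
  "pidx n = {(i, j). 1 \<le> i \<and> i < j \<and> j \<le> 2 * n}"

type_synonym 'a mpoly = "((nat \<times> nat) \<Rightarrow>\<^sub>0 nat) \<Rightarrow>\<^sub>0 'a"

definition monom_eval :: "((nat \<times> nat) \<Rightarrow>\<^sub>0 nat) \<Rightarrow> (nat \<times> nat \<Rightarrow> 'a::comm_ring_1) \<Rightarrow> 'a" where
  "monom_eval m x = (\<Prod>J\<in>Poly_Mapping.keys m. x J ^ Poly_Mapping.lookup m J)"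

definition mpoly_eval :: "'a::comm_ring_1 mpoly \<Rightarrow> (nat \<times> nat \<Rightarrow> 'a) \<Rightarrow> 'a" where
  "mpoly_eval f x = (\<Sum>m\<in>Poly_Mapping.keys f. Poly_Mapping.lookup f m * monom_eval m x)"

definition mpoly_vars :: "'a::zero mpoly \<Rightarrow> (nat \<times> nat) set" where
  "mpoly_vars f = (\<Union>u\<in>Poly_Mapping.keys f. Poly_Mapping.keys u)"

definition alg_closed :: "'a::field itself \<Rightarrow> bool" where
  "alg_closed _ \<longleftrightarrow> (\<forall>q::'a poly. degree q \<noteq> 0 \<longrightarrow> (\<exists>x. poly q x = 0))"

definition nonarch_valuation :: "('a::field \<Rightarrow> ereal) \<Rightarrow> bool" where
  "nonarch_valuation val \<longleftrightarrow>
     val 0 = \<infinity> \<and>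
     (\<forall>x. x \<noteq> 0 \<longrightarrow> (\<exists>r::real. val x = ereal r)) \<and>
     (\<forall>x y. val (x * y) = val x + val y) \<and>
     (\<forall>x y. min (val x) (val y) \<le> val (x + y))"

definition symp_form :: "nat \<Rightarrow> (nat \<Rightarrow> 'a::comm_ring_1) \<Rightarrow> (nat \<Rightarrow> 'a) \<Rightarrow> 'a" where
  "symp_form n v w = (\<Sum>i=1..n. v i * w (bar n i) - v (bar n i) * w i)"

definition lin_indep2 :: "nat \<Rightarrow> (nat \<Rightarrow> 'a::field) \<Rightarrow> (nat \<Rightarrow> 'a) \<Rightarrow> bool" where
  "lin_indep2 n v w \<longleftrightarrow>
     (\<forall>a b. (\<forall>i\<in>{1..2*n}. a * v i + b * w i = 0) \<longrightarrow> a = 0 \<and> b = 0)"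

definition pluecker_vec :: "(nat \<Rightarrow> 'a::comm_ring_1) \<Rightarrow> (nat \<Rightarrow> 'a) \<Rightarrow> nat \<times> nat \<Rightarrow> 'a" where
  "pluecker_vec v w = (\<lambda>(i, j). v i * w j - v j * w i)"

text \<open>The ideal S_{2,2n}(K): polynomials in the variables X_J, J \<in> pidx n, vanishing
  on the Plucker vectors of all 2-dimensional isotropic subspaces of K^{2n}
  (such a subspace is spanned by two linearly independent v, w with \<omega>(v,w)=0;
  the Plucker vector is defined up to scaling, and vanishing of a polynomial on
  the whole set of spanning pairs covers every choice of basis).\<close>
definition S_ideal :: "nat \<Rightarrow> 'a::field mpoly set" where
  "S_ideal n = {f. mpoly_vars f \<subseteq> pidx n \<and>
     (\<forall>v w :: nat \<Rightarrow> 'a. lin_indep2 n v w \<and> symp_form n v w = 0 \<longrightarrow>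
         mpoly_eval f (pluecker_vec v w) = 0)}"

definition mdot :: "((nat \<times> nat) \<Rightarrow>\<^sub>0 nat) \<Rightarrow> (nat \<times> nat \<Rightarrow> ereal) \<Rightarrow> ereal" where
  "mdot u w = (\<Sum>J\<in>Poly_Mapping.keys u. ereal (real (Poly_Mapping.lookup u J)) * w J)"

text \<open>Tropical hypersurface: the minimum over the monomials of val(c_u) + u\<cdot>w is
  attained at least twice, or is \<infinity> (this includes f = 0).\<close>
definition trop_hyp :: "('a::field \<Rightarrow> ereal) \<Rightarrow> 'a mpoly \<Rightarrow> (nat \<times> nat \<Rightarrow> ereal) \<Rightarrow> bool" where
  "trop_hyp val f w \<longleftrightarrow>
     (let t = (\<lambda>u. val (Poly_Mapping.lookup f u) + mdot u w) in
       (\<forall>u\<in>Poly_Mapping.keys f. t u = \<infinity>) \<or>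
       (\<exists>u1\<in>Poly_Mapping.keys f. \<exists>u2\<in>Poly_Mapping.keys f. u1 \<noteq> u2 \<and> t u1 = t u2 \<and> (\<forall>u\<in>Poly_Mapping.keys f. t u1 \<le> t u)))"

text \<open>Representatives of points of TP^{N-1}, N = binom(2n,2).\<close>
definition tp_point :: "nat \<Rightarrow> (nat \<times> nat \<Rightarrow> ereal) \<Rightarrow> bool" where
  "tp_point n w \<longleftrightarrow> (\<forall>J\<in>pidx n. w J \<noteq> -\<infinity>) \<and> (\<exists>J\<in>pidx n. w J \<noteq> \<infinity>)"

definition TSpGr :: "('a::field \<Rightarrow> ereal) \<Rightarrow> nat \<Rightarrow> (nat \<times> nat \<Rightarrow> ereal) set" where
  "TSpGr val n = {w. tp_point n w \<and> (\<forall>f\<in>(S_ideal n :: 'a mpoly set). trop_hyp val f w)}"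


definition SpDr :: "nat \<Rightarrow> (nat \<times> nat \<Rightarrow> ereal) set" where
  "SpDr n = {\<mu>. tp_point n \<mu> \<and>
     (\<forall>i j k l. 1 \<le> i \<and> i < j \<and> j < k \<and> k < l \<and> l \<le> 2 * n \<longrightarrow>
        (let a = \<mu> (i, j) + \<mu> (k, l); b = \<mu> (i, k) + \<mu> (j, l); c = \<mu> (i, l) + \<mu> (j, k);
             m = min a (min b c) in
          (a = m \<and> b = m) \<or> (a = m \<and> c = m) \<or> (b = m \<and> c = m))) \<and>
     (let m = Min ((\<lambda>i. \<mu> (i, bar n i)) ` {1..n}) in
        m = \<infinity> \<or> (\<exists>i\<in>{1..n}. \<exists>j\<in>{1..n}. i \<noteq> j \<and> \<mu> (i, bar n i) = m \<and> \<mu> (j, bar n j) = m))}"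

end

theory Submission
  imports Defs "HOL-Library.Product_Lexorder"
begin

text \<open>Both families of relations lie in the ideal, which gives one inclusion. Conversely, a
  point \<open>\<mu>\<close> of \<open>SpDr n\<close> is lifted to an isotropic pair of vectors over the polynomial ring
  over the ground field, equipped with a Gauss valuation in which every variable has a
  prescribed real weight; this works for any value group, the trivial one included. First the
  tropical Pluecker relations exhibit \<open>\<mu>\<close> as an ultrametric up to rescaling, which is lifted
  one point at a time with fresh variables. Then two coordinates at which the minimum of the
  symplectic relation is attained are rescaled so that the relation holds exactly. A polynomial
  in the ideal vanishes at the lift, so its minimum at \<open>\<mu>\<close> is attained twice.\<close>

section \<open>Valuations on commutative rings\<close>

text \<open>A lift over the ground field would need elements with the given real valuations and
  residues generic enough to avoid cancellation. New variables supply both: a variable takes any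
  prescribed weight, and one absent from the rest of an expression cannot cancel against it.
  Constants keep their valuation, so the terms of a polynomial in the ideal, evaluated at the lift,
  have exactly the values compared by \<open>trop_hyp\<close>. The price is that only a ring is
  available: hence valuations on commutative rings, and denominators that have to be cleared.
  Weights are finite, so a coordinate \<infinity> must be lifted to the polynomial 0; most case
  distinctions come from this. The variables reuse the index pairs of \<open>mpoly\<close> in three
  blocks: \<open>(0, k)\<close> for distances, \<open>(1, k)\<close> for column scalings,
  \<open>(2, 0)\<close> and \<open>(2, 1)\<close> for the symplectic step.\<close>

locale ring_valuation =
  fixes val :: "'r::comm_ring_1 \<Rightarrow> ereal"
  assumes eq_infinity_iff: "val x = \<infinity> \<longleftrightarrow> x = 0"
    and not_MInfty: "val x \<noteq> -\<infinity>"
    and mult: "val (x * y) = val x + val y"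
    and add_ge: "min (val x) (val y) \<le> val (x + y)"
begin

lemma zero: "val 0 = \<infinity>"
  by (simp add: eq_infinity_iff)

lemma one: "val 1 = 0"
proof -
  have "val 1 = val 1 + val 1" "val 1 \<noteq> \<infinity>" "val 1 \<noteq> -\<infinity>"
    using mult[of 1 1] not_MInfty[of 1] by (simp_all add: eq_infinity_iff)
  then show ?thesis by (cases "val 1") auto
qed

lemma minus_one: "val (- 1) = 0"
proof -
  have "val (-1) + val (-1) = 0" "val (-1) \<noteq> -\<infinity>"
    using mult[of "-1" "-1"] one not_MInfty by simp_all
  then show ?thesis by (cases "val (-1)") auto
qed

lemma minus: "val (- x) = val x"
  using mult[of "-1" x] by (simp add: minus_one)

lemma add_eq_left:
  assumes "val x < val y"
  shows "val (x + y) = val x"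
proof (rule antisym)
  show "val x \<le> val (x + y)"
    using add_ge[of x y] assms by (simp add: min_def split: if_splits)
  \<comment> \<open>Write \<open>x\<close> as \<open>(x + y) + (- y)\<close>; as
    \<open>val y\<close> exceeds \<open>val x\<close>, the minimum must be
    \<open>val (x + y)\<close>.\<close>
  have "min (val (x + y)) (val y) \<le> val x"
    using add_ge[of "x + y" "- y"] by (simp add: minus)
  then show "val (x + y) \<le> val x"
    using assms by (auto simp: min_def split: if_splits)
qed

lemma sum_ge:
  assumes "\<And>i. i \<in> A \<Longrightarrow> c \<le> val (f i)"
  shows "c \<le> val (sum f A)"
  using assms
proof (induction A rule: infinite_finite_induct)
  case (insert i A)
  then have "c \<le> min (val (f i)) (val (sum f A))" by simp
  also note add_ge
  finally show ?case using insert.hyps by simp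
qed (simp_all add: zero)

lemma sum_unique_min:
  assumes "finite A" "a \<in> A" "\<And>i. i \<in> A - {a} \<Longrightarrow> val (f a) < val (f i)"
  shows "val (sum f A) = val (f a)"
proof (cases "A - {a} = {}")
  case True
  then have "A = {a}" using \<open>a \<in> A\<close> by blast
  then show ?thesis by simp
next
  case False
  define c where "c = Min ((\<lambda>i. val (f i)) ` (A - {a}))"
  have "c \<in> (\<lambda>i. val (f i)) ` (A - {a})"
    unfolding c_def using assms(1) False by (intro Min_in) auto
  then have "val (f a) < c"
    using assms(3) by auto
  also have "c \<le> val (sum f (A - {a}))"
    unfolding c_def using assms(1) by (intro sum_ge Min_le) auto
  finally have "val (f a + sum f (A - {a})) = val (f a)"
    by (rule add_eq_left)
  then show ?thesis
    using assms(1,2) by (simp add: sum.remove)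
qed

text \<open>A unique finite minimum would be the value of the whole sum, whereas 0 has value
  \<infinity>. The two alternatives are shaped like those of \<open>trop_hyp\<close>.\<close>

lemma sum_eq_zero_min_twice:
  assumes "finite A" "sum f A = 0"
  shows "(\<forall>i\<in>A. val (f i) = \<infinity>) \<or>
    (\<exists>i\<in>A. \<exists>j\<in>A. i \<noteq> j \<and> val (f i) = val (f j) \<and> (\<forall>k\<in>A. val (f i) \<le> val (f k)))"
proof (cases "\<forall>i\<in>A. val (f i) = \<infinity>")
  case False
  then have "A \<noteq> {}" by auto
  define i where "i = arg_min_on (\<lambda>i. val (f i)) A"
  have i: "i \<in> A" "\<And>k. k \<in> A \<Longrightarrow> val (f i) \<le> val (f k)"
    unfolding i_def using assms(1) \<open>A \<noteq> {}\<close> by (auto intro: arg_min_if_finite(1) arg_min_least)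
  have "\<exists>j\<in>A. i \<noteq> j \<and> val (f j) \<le> val (f i)"
  proof (rule ccontr)
    assume "\<not> ?thesis"
    then have "val (sum f A) = val (f i)"
      using assms(1) i(1) by (intro sum_unique_min) (auto simp: not_le)
    with assms(2) have "val (f i) = \<infinity>" by (simp add: zero)
    with i False show False by auto
  qed
  with i show ?thesis by (metis antisym)
qed simp

text \<open>For \<open>x = 0\<close> and \<open>k = 0\<close> this relies on the convention 0 *
  \<infinity> = 0 of \<open>ereal\<close>, which matches \<open>x ^ 0 = 1\<close>.\<close>

lemma power: "val (x ^ k) = ereal (real k) * val x"
proof (induction k)
  case (Suc k)
  then have "val (x ^ Suc k) = val x + ereal (real k) * val x"
    by (simp add: mult)
  also have "\<dots> = ereal (real (Suc k)) * val x"
    using not_MInfty[of x] by (cases "val x") (auto simp: algebra_simps)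
  finally show ?case .
qed (simp add: one)

lemma prod: "val (prod f A) = (\<Sum>i\<in>A. val (f i))"
  by (induction A rule: infinite_finite_induct) (simp_all add: one mult)

lemma monom_eval: "val (monom_eval u x) = mdot u (\<lambda>J. val (x J))"
  by (simp add: monom_eval_def mdot_def prod power)

end

lemma ring_valuation_of_nonarch:
  assumes "nonarch_valuation val"
  shows "ring_valuation val"
proof
  fix x y
  show "val x = \<infinity> \<longleftrightarrow> x = 0" "val x \<noteq> -\<infinity>"
    using assms unfolding nonarch_valuation_def by (cases "x = 0"; force)+
qed (use assms in \<open>auto simp: nonarch_valuation_def\<close>)


section \<open>Evaluation of polynomials\<close>

lemma poly_mapping_eq_sum_single:
  "p = (\<Sum>m\<in>Poly_Mapping.keys p. Poly_Mapping.single m (Poly_Mapping.lookup p m))"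
  by (rule poly_mapping_eqI)
    (simp add: lookup_sum lookup_single when_def sum.delta' in_keys_iff)

lemma poly_mapping_mult_eq_sum:
  fixes p q :: "'m::monoid_add \<Rightarrow>\<^sub>0 'a::semiring_0"
  shows "p * q = (\<Sum>(l, m)\<in>Poly_Mapping.keys p \<times> Poly_Mapping.keys q.
    Poly_Mapping.single (l + m) (Poly_Mapping.lookup p l * Poly_Mapping.lookup q m))"
  by (subst poly_mapping_eq_sum_single[of p], subst poly_mapping_eq_sum_single[of q])
    (simp add: sum_product mult_single sum.cartesian_product)

lemma monom_eval_superset:
  assumes "finite A" "Poly_Mapping.keys m \<subseteq> A"
  shows "monom_eval m x = (\<Prod>J\<in>A. x J ^ Poly_Mapping.lookup m J)"
  unfolding monom_eval_def
  using assms by (intro prod.mono_neutral_left) (auto simp: in_keys_iff)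

lemma monom_eval_add: "monom_eval (l + m) x = monom_eval l x * monom_eval m x"
proof -
  let ?A = "Poly_Mapping.keys l \<union> Poly_Mapping.keys m"
  show ?thesis
    using monom_eval_superset[of ?A l x] monom_eval_superset[of ?A m x]
      monom_eval_superset[of ?A "l + m" x] keys_add[of l m]
    by (simp add: lookup_add power_add prod.distrib)
qed

lemma mpoly_eval_superset:
  assumes "finite A" "Poly_Mapping.keys f \<subseteq> A"
  shows "mpoly_eval f x = (\<Sum>m\<in>A. Poly_Mapping.lookup f m * monom_eval m x)"
  unfolding mpoly_eval_def
  using assms by (intro sum.mono_neutral_left) (auto simp: in_keys_iff)

lemma mpoly_eval_add: "mpoly_eval (f + g) x = mpoly_eval f x + mpoly_eval g x"
proof -
  let ?A = "Poly_Mapping.keys f \<union> Poly_Mapping.keys g"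
  show ?thesis
    using mpoly_eval_superset[of ?A f x] mpoly_eval_superset[of ?A g x]
      mpoly_eval_superset[of ?A "f + g" x] keys_add[of f g]
    by (simp add: lookup_add distrib_right sum.distrib)
qed

lemma mpoly_eval_zero [simp]: "mpoly_eval 0 x = 0"
  by (simp add: mpoly_eval_def)

lemma mpoly_eval_sum: "mpoly_eval (sum f A) x = (\<Sum>i\<in>A. mpoly_eval (f i) x)"
  by (induction A rule: infinite_finite_induct) (simp_all add: mpoly_eval_add)

lemma mpoly_eval_uminus: "mpoly_eval (- f) x = - mpoly_eval f x"
  using mpoly_eval_add[of f "- f" x] by (simp add: eq_neg_iff_add_eq_0 add.commute)

lemma mpoly_eval_diff: "mpoly_eval (f - g) x = mpoly_eval f x - mpoly_eval g x"
  using mpoly_eval_add[of f "- g" x] by (simp add: mpoly_eval_uminus)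

lemma mpoly_eval_single: "mpoly_eval (Poly_Mapping.single m c) x = c * monom_eval m x"
  using mpoly_eval_superset[of "{m}" "Poly_Mapping.single m c" x] by simp

lemma mpoly_eval_mult: "mpoly_eval (f * g) x = mpoly_eval f x * mpoly_eval g x"
  by (subst poly_mapping_mult_eq_sum)
    (simp add: mpoly_eval_sum case_prod_unfold mpoly_eval_single monom_eval_add
      mpoly_eval_def[of f] mpoly_eval_def[of g] sum_product sum.cartesian_product mult_ac)

lemma mpoly_eval_one [simp]: "mpoly_eval 1 x = 1"
  using mpoly_eval_single[of 0 1 x] by (simp add: monom_eval_def)

lemma mpoly_eval_power: "mpoly_eval (f ^ k) x = mpoly_eval f x ^ k"
  by (induction k) (simp_all add: mpoly_eval_mult)

lemma mpoly_eval_prod: "mpoly_eval (prod f A) x = (\<Prod>i\<in>A. mpoly_eval (f i) x)"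
  by (induction A rule: infinite_finite_induct) (simp_all add: mpoly_eval_mult)

text \<open>The value of \<open>f\<close> at a point over the polynomial ring.
  \<open>mpoly_eval\<close> cannot express it, since there the coefficients and the point share one
  ring; here the coefficients are embedded as constants.\<close>

definition mpoly_subst :: "'a::comm_ring_1 mpoly \<Rightarrow> (nat \<times> nat \<Rightarrow> 'a mpoly) \<Rightarrow> 'a mpoly" where
  "mpoly_subst f P = (\<Sum>u\<in>Poly_Mapping.keys f.
     Poly_Mapping.single 0 (Poly_Mapping.lookup f u) * monom_eval u P)"

lemma mpoly_eval_mpoly_subst:
  "mpoly_eval (mpoly_subst f P) x = mpoly_eval f (\<lambda>J. mpoly_eval (P J) x)"
proof -
  have "mpoly_eval (monom_eval u P) x = monom_eval u (\<lambda>J. mpoly_eval (P J) x)" for u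
    by (simp add: monom_eval_def mpoly_eval_prod mpoly_eval_power)
  then show ?thesis
    by (simp add: mpoly_subst_def mpoly_eval_sum mpoly_eval_mult mpoly_eval_single
        mpoly_eval_def[of f] monom_eval_def[of 0])
qed

text \<open>Over a finite field, 1 plus the product of all \<open>X - a\<close> has positive degree
  and no root.\<close>

lemma alg_closed_infinite:
  assumes "alg_closed TYPE('a::field)"
  shows "infinite (UNIV :: 'a::field set)"
proof
  assume fin: "finite (UNIV :: 'a set)"
  let ?p = "\<Prod>a\<in>(UNIV :: 'a set). [:- a, 1:]"
  have deg: "degree ?p = card (UNIV :: 'a set)"
    by (subst degree_prod_eq_sum_degree) auto
  have "degree (?p + 1) = degree ?p"
    using deg fin by (intro degree_add_eq_left) (simp add: card_gt_0_iff)
  then have "degree (?p + 1) \<noteq> 0"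
    using deg fin by simp
  then obtain x where "poly (?p + 1) x = 0"
    using assms unfolding alg_closed_def by blast
  moreover have "poly ?p x = 0"
    using fin by (auto simp: poly_prod)
  ultimately show False by simp
qed

text \<open>Set every coordinate to 1 except one at which the exponents differ; there any non-root
  of the difference of the two powers works.\<close>

lemma monom_eval_separates:
  fixes l m :: "(nat \<times> nat) \<Rightarrow>\<^sub>0 nat"
  assumes "infinite (UNIV :: 'a::field set)" "l \<noteq> m"
  obtains b :: "nat \<times> nat \<Rightarrow> 'a::field" where "monom_eval l b \<noteq> monom_eval m b"
proof -
  obtain J where J: "Poly_Mapping.lookup l J \<noteq> Poly_Mapping.lookup m J"
    using \<open>l \<noteq> m\<close> by (metis poly_mapping_eqI)
  let ?q = "monom 1 (Poly_Mapping.lookup l J) - monom 1 (Poly_Mapping.lookup m J) :: 'a poly"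
  have "coeff ?q (Poly_Mapping.lookup l J) = 1"
    using J by simp
  then have "?q \<noteq> 0"
    by (metis coeff_0 zero_neq_one)
  then have "finite {x. poly ?q x = 0}"
    by (rule poly_roots_finite)
  then obtain x where x: "poly ?q x \<noteq> 0"
    using ex_new_if_finite[OF assms(1)] by blast
  define b where "b = (\<lambda>_. 1 :: 'a)(J := x)"
  have "monom_eval u b = x ^ Poly_Mapping.lookup u J" for u
  proof -
    have "monom_eval u b = (\<Prod>I\<in>insert J (Poly_Mapping.keys u). b I ^ Poly_Mapping.lookup u I)"
      by (rule monom_eval_superset) auto
    also have "\<dots> = (\<Prod>I\<in>{J}. b I ^ Poly_Mapping.lookup u I)"
      by (rule prod.mono_neutral_right) (auto simp: b_def)
    finally show ?thesis by (simp add: b_def)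
  qed
  then show ?thesis
    using x by (intro that[of b]) (simp add: poly_monom)
qed

text \<open>Monomials are characters of the multiplicative monoid of points, so Dedekind's
  argument shows that they are linearly independent.\<close>

lemma monom_eval_independent:
  fixes c :: "((nat \<times> nat) \<Rightarrow>\<^sub>0 nat) \<Rightarrow> 'a::field"
  assumes "infinite (UNIV :: 'a set)" "finite A"
    and "\<And>x. (\<Sum>u\<in>A. c u * monom_eval u x) = 0"
  shows "\<forall>u\<in>A. c u = 0"
  using assms(2,3)
proof (induction A arbitrary: c rule: finite_induct)
  case (insert m A)
  have mult: "monom_eval u (\<lambda>J. a J * b J) = monom_eval u a * monom_eval u b"
    for u and a b :: "nat \<times> nat \<Rightarrow> 'a"
    by (simp add: monom_eval_def power_mult_distrib prod.distrib)
  have *: "c u * (monom_eval u b - monom_eval m b) = 0" if "u \<in> A" for u b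
  proof -
    have "(\<Sum>u\<in>A. c u * (monom_eval u b - monom_eval m b) * monom_eval u x) = 0" for x
    proof -
      \<comment> \<open>The relation at the twisted point minus \<open>monom_eval m b\<close> times
        the relation at \<open>x\<close>: the term of \<open>m\<close> drops out, leaving a shorter
        relation.\<close>
      have "(\<Sum>u\<in>insert m A. c u * monom_eval u (\<lambda>J. x J * b J))
          - monom_eval m b * (\<Sum>u\<in>insert m A. c u * monom_eval u x) = 0"
        by (simp only: insert.prems mult_zero_right diff_zero)
      then show ?thesis
        using insert.hyps
        by (simp add: mult sum_distrib_left algebra_simps sum_subtractf)
    qed
    then show ?thesis
      using insert.IH[of "\<lambda>u. c u * (monom_eval u b - monom_eval m b)"] that by blast
  qed
  have A: "c u = 0" if "u \<in> A" for u
  proof -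
    have "u \<noteq> m" using that insert.hyps(2) by blast
    then obtain b :: "nat \<times> nat \<Rightarrow> 'a" where "monom_eval u b \<noteq> monom_eval m b"
      by (rule monom_eval_separates[OF assms(1)])
    with *[OF that, of b] show ?thesis by simp
  qed
  then have "c m * monom_eval m (\<lambda>_. 1) = 0"
    using insert.prems[of "\<lambda>_. 1"] insert.hyps by simp
  with A show ?case by (simp add: monom_eval_def)
qed simp

lemma mpoly_eq_zeroI:
  fixes f :: "'a::field mpoly"
  assumes "infinite (UNIV :: 'a set)" "\<And>x. mpoly_eval f x = 0"
  shows "f = 0"
proof -
  have "\<forall>u\<in>Poly_Mapping.keys f. Poly_Mapping.lookup f u = 0"
    using assms(2) by (intro monom_eval_independent[OF assms(1)]) (simp_all add: mpoly_eval_def)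
  then show ?thesis
    by (intro poly_mapping_eqI) (simp add: in_keys_iff)
qed


section \<open>The weighted Gauss valuation\<close>

text \<open>A counterpart of \<open>mdot\<close> with real weights, so that it is always finite and
  can be subtracted.\<close>

definition wdot :: "(nat \<times> nat \<Rightarrow> real) \<Rightarrow> ((nat \<times> nat) \<Rightarrow>\<^sub>0 nat) \<Rightarrow> real" where
  "wdot wt u = (\<Sum>J\<in>Poly_Mapping.keys u. real (Poly_Mapping.lookup u J) * wt J)"

text \<open>An infimum instead of \<open>Min\<close>, so that the empty support of 0 yields
  \<infinity>.\<close>

definition gval :: "('a::zero \<Rightarrow> ereal) \<Rightarrow> (nat \<times> nat \<Rightarrow> real) \<Rightarrow> 'a mpoly \<Rightarrow> ereal" where
  "gval val wt f = (INF u\<in>Poly_Mapping.keys f. val (Poly_Mapping.lookup f u) + ereal (wdot wt u))"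

lemma wdot_add: "wdot wt (l + m) = wdot wt l + wdot wt m"
proof -
  let ?A = "Poly_Mapping.keys l \<union> Poly_Mapping.keys m"
  have "wdot wt u = (\<Sum>J\<in>?A. real (Poly_Mapping.lookup u J) * wt J)"
    if "Poly_Mapping.keys u \<subseteq> ?A" for u
    unfolding wdot_def using that by (intro sum.mono_neutral_left) (auto simp: in_keys_iff)
  from this[of l] this[of m] this[of "l + m"] show ?thesis
    using keys_add[of l m] by (simp add: lookup_add algebra_simps sum.distrib)
qed

lemma wdot_single: "wdot wt (Poly_Mapping.single J k) = real k * wt J"
  by (cases "k = 0") (simp_all add: wdot_def)

lemma wdot_zero: "wdot wt 0 = 0"
  by (simp add: wdot_def)

lemma gval_attained:
  assumes "f \<noteq> 0"
  obtains u where "u \<in> Poly_Mapping.keys f"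
    "gval val wt f = val (Poly_Mapping.lookup f u) + ereal (wdot wt u)"
proof -
  let ?t = "\<lambda>u. val (Poly_Mapping.lookup f u) + ereal (wdot wt u)"
  have ne: "?t ` Poly_Mapping.keys f \<noteq> {}" "finite (?t ` Poly_Mapping.keys f)"
    using assms by auto
  then have "gval val wt f = Min (?t ` Poly_Mapping.keys f)"
    unfolding gval_def by (simp add: Min_Inf)
  then have "gval val wt f \<in> ?t ` Poly_Mapping.keys f"
    using Min_in[OF ne(2,1)] by simp
  then show ?thesis using that by auto
qed

lemma gval_cong:
  assumes "\<And>J. J \<in> mpoly_vars f \<Longrightarrow> wt J = wt' J"
  shows "gval val wt f = gval val wt' f"
  unfolding gval_def wdot_def
  by (intro INF_cong refl arg_cong2[where f = "(+)"] arg_cong[where f = ereal] sum.cong)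
    (use assms in \<open>auto simp: mpoly_vars_def\<close>)

context ring_valuation
begin

abbreviation gv :: "(nat \<times> nat \<Rightarrow> real) \<Rightarrow> 'r mpoly \<Rightarrow> ereal" where
  "gv \<equiv> gval val"

lemma gval_le:
  "gv wt f \<le> val (Poly_Mapping.lookup f u) + ereal (wdot wt u)"
proof (cases "u \<in> Poly_Mapping.keys f")
  case True
  then show ?thesis unfolding gval_def by (rule INF_lower)
qed (simp add: in_keys_iff zero)

lemma gval_single: "gv wt (Poly_Mapping.single u c) = val c + ereal (wdot wt u)"
  by (cases "c = 0") (simp_all add: gval_def zero top_ereal_def)

lemma gval_add_ge: "min (gv wt f) (gv wt g) \<le> gv wt (f + g)"
  unfolding gval_def[of _ _ "f + g"]
proof (rule INF_greatest)
  fix u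
  have "min (gv wt f) (gv wt g)
      \<le> min (val (Poly_Mapping.lookup f u) + ereal (wdot wt u))
            (val (Poly_Mapping.lookup g u) + ereal (wdot wt u))"
    by (intro min.mono gval_le)
  also have "\<dots> = min (val (Poly_Mapping.lookup f u)) (val (Poly_Mapping.lookup g u)) + ereal (wdot wt u)"
    by (simp add: min_def ereal_add_le_add_iff2)
  also have "\<dots> \<le> val (Poly_Mapping.lookup (f + g) u) + ereal (wdot wt u)"
    by (intro add_right_mono) (simp add: lookup_add add_ge)
  finally show "min (gv wt f) (gv wt g) \<le> val (Poly_Mapping.lookup (f + g) u) + ereal (wdot wt u)" .
qed

text \<open>Each coefficient of either summand survives unchanged in the sum, so nothing can
  cancel.\<close>

lemma gval_add_disjoint:
  assumes "Poly_Mapping.keys f \<inter> Poly_Mapping.keys g = {}"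
  shows "gv wt (f + g) = min (gv wt f) (gv wt g)"
proof (rule antisym)
  have "gv wt (f + g) \<le> gv wt f" if "Poly_Mapping.keys f \<inter> Poly_Mapping.keys g = {}" for f g
    unfolding gval_def[of _ _ f]
  proof (rule INF_greatest)
    fix u assume "u \<in> Poly_Mapping.keys f"
    then have "Poly_Mapping.lookup g u = 0"
      using that by (auto simp: in_keys_iff)
    then show "gv wt (f + g) \<le> val (Poly_Mapping.lookup f u) + ereal (wdot wt u)"
      using gval_le[of wt "f + g" u] by (simp add: lookup_add)
  qed
  from this[of f g] this[of g f] assms
  show "gv wt (f + g) \<le> min (gv wt f) (gv wt g)"
    by (simp add: Int_commute add.commute)
qed (rule gval_add_ge)

lemma gval_eq_infinity_iff: "gv wt f = \<infinity> \<longleftrightarrow> f = 0"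
proof
  assume inf: "gv wt f = \<infinity>"
  show "f = 0"
  proof (rule ccontr)
    assume "f \<noteq> 0"
    then obtain u where "u \<in> Poly_Mapping.keys f"
      "gv wt f = val (Poly_Mapping.lookup f u) + ereal (wdot wt u)"
      by (rule gval_attained)
    with inf show False
      by (auto simp: eq_infinity_iff in_keys_iff)
  qed
qed (simp add: gval_def top_ereal_def)

lemma gval_not_MInfty: "gv wt f \<noteq> -\<infinity>"
proof (cases "f = 0")
  case False
  then obtain u where "gv wt f = val (Poly_Mapping.lookup f u) + ereal (wdot wt u)"
    by (rule gval_attained)
  then show ?thesis using not_MInfty by auto
qed (simp add: gval_def top_ereal_def)

text \<open>Among the monomials where the minimum is attained, the smallest ones of the two
  factors for a monomial order multiply to a monomial without cancellation.\<close>

lemma gval_mult_nonzero: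
  assumes "f \<noteq> 0" "g \<noteq> 0"
  shows "gv wt (f * g) = gv wt f + gv wt g"
proof -
  define t where "t f u = val (Poly_Mapping.lookup f u) + ereal (wdot wt u)" for f u
  have t_ge: "gv wt f \<le> t f u" for f u
    unfolding t_def by (rule gval_le)
  define F where "F f = {u \<in> Poly_Mapping.keys f. t f u = gv wt f}" for f
  \<comment> \<open>The monomial order is linear because the index pairs are, by their lexicographic
    order; below, its compatibility with addition is what matters.\<close>
  have ex: "\<exists>a\<in>F f. \<forall>u\<in>F f. a \<le> u" if nz: "f \<noteq> 0" for f
  proof -
    obtain u where "u \<in> Poly_Mapping.keys f" "gv wt f = t f u"
      using nz unfolding t_def by (rule gval_attained)
    then have "F f \<noteq> {}" "finite (F f)" unfolding F_def by auto
    then show ?thesis using Min_in Min_le by meson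
  qed
  obtain a where a: "a \<in> F f" "\<And>u. u \<in> F f \<Longrightarrow> a \<le> u"
    using ex[OF assms(1)] by blast
  obtain b where b: "b \<in> F g" "\<And>u. u \<in> F g \<Longrightarrow> b \<le> u"
    using ex[OF assms(2)] by blast
  let ?K = "Poly_Mapping.keys f \<times> Poly_Mapping.keys g"
  define c where "c l m = Poly_Mapping.lookup f l * Poly_Mapping.lookup g m" for l m
  have fin: "finite ?K" by simp
  have lookup: "Poly_Mapping.lookup (f * g) k
      = (\<Sum>(l, m)\<in>{(l, m)\<in>?K. l + m = k}. c l m)" for k
    by (subst poly_mapping_mult_eq_sum)
      (auto simp: lookup_sum case_prod_unfold lookup_single when_def c_def
        simp flip: sum.inter_filter[OF fin] intro!: sum.cong)
  have c: "val (c l m) + ereal (wdot wt (l + m)) = t f l + t g m" for l m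
    by (simp add: t_def c_def mult wdot_add add_ac flip: plus_ereal.simps(1))
  have finite_t: "\<bar>gv wt f\<bar> \<noteq> \<infinity>" "\<bar>gv wt g\<bar> \<noteq> \<infinity>"
    using assms gval_eq_infinity_iff[of wt] gval_not_MInfty[of wt] by auto
  show ?thesis
  proof (rule antisym)
    let ?k = "a + b"
    let ?S = "{(l, m)\<in>?K. l + m = ?k}"
    have "val (\<Sum>(l, m)\<in>?S. c l m) = val (case (a, b) of (l, m) \<Rightarrow> c l m)"
    proof (rule sum_unique_min)
      show "finite ?S" using fin by (rule finite_subset[rotated]) auto
      show "(a, b) \<in> ?S" using a(1) b(1) by (auto simp: F_def)
    next
      fix z assume z: "z \<in> ?S - {(a, b)}"
      obtain l m where lm: "z = (l, m)" by (cases z)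
      then have *: "l + m = a + b" "(l, m) \<noteq> (a, b)"
        "l \<in> Poly_Mapping.keys f" "m \<in> Poly_Mapping.keys g"
        using z by auto
      have "l \<notin> F f \<or> m \<notin> F g"
      proof (rule ccontr)
        assume "\<not> ?thesis"
        then have "a \<le> l" "b \<le> m" using a b by auto
        then have "a = l \<and> b = m"
          using *(1) by (metis add_le_cancel_left add_le_cancel_right antisym)
        with *(2) show False by simp
      qed
      then have "gv wt f < t f l \<or> gv wt g < t g m"
        using *(3,4) t_ge[of f l] t_ge[of g m] by (auto simp: F_def order.strict_iff_order)
      \<comment> \<open>Strictness in one factor survives the addition because both Gauss values are
        finite.\<close>
      then have "gv wt f + gv wt g < t f l + t g m"
        using finite_t t_ge[of f l] t_ge[of g m]
        by (cases "t f l"; cases "t g m"; cases "gv wt f"; cases "gv wt g") auto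
      moreover have "t f a + t g b = gv wt f + gv wt g"
        using a(1) b(1) by (simp add: F_def)
      ultimately have "val (c a b) + ereal (wdot wt ?k) < val (c l m) + ereal (wdot wt ?k)"
        using c[of a b] c[of l m] *(1) by simp
      then show "val (case (a, b) of (l, m) \<Rightarrow> c l m) < val (case z of (l, m) \<Rightarrow> c l m)"
        by (simp add: lm ereal_add_strict_mono less_le) (auto simp: ereal_add_le_add_iff2)
    qed
    then have "val (Poly_Mapping.lookup (f * g) ?k) + ereal (wdot wt ?k) = t f a + t g b"
      using c[of a b] by (simp add: lookup)
    also have "\<dots> = gv wt f + gv wt g"
      using a(1) b(1) by (simp add: F_def)
    finally show "gv wt (f * g) \<le> gv wt f + gv wt g"
      using gval_le[of wt "f * g" ?k] by simp
  next
    show "gv wt f + gv wt g \<le> gv wt (f * g)"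
      unfolding gval_def[of _ _ "f * g"]
    proof (rule INF_greatest)
      fix k
      have "gv wt f + gv wt g - ereal (wdot wt k) \<le> val (Poly_Mapping.lookup (f * g) k)"
        unfolding lookup
      proof (rule sum_ge)
        fix z assume "z \<in> {(l, m)\<in>?K. l + m = k}"
        then obtain l m where lm: "z = (l, m)" "l + m = k" by auto
        have "gv wt f + gv wt g \<le> t f l + t g m"
          by (intro add_mono t_ge)
        then show "gv wt f + gv wt g - ereal (wdot wt k) \<le> val (case z of (l, m) \<Rightarrow> c l m)"
          using c[of l m] lm by (simp add: ereal_minus_le_iff add.commute)
      qed
      then show "gv wt f + gv wt g \<le> val (Poly_Mapping.lookup (f * g) k) + ereal (wdot wt k)"
        by (simp add: ereal_minus_le_iff add.commute)
    qed
  qed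
qed

lemma ring_valuation_gval: "ring_valuation (gv wt)"
proof
  fix f g :: "'r mpoly"
  show "gv wt f = \<infinity> \<longleftrightarrow> f = 0" by (rule gval_eq_infinity_iff)
  show "gv wt f \<noteq> -\<infinity>" by (rule gval_not_MInfty)
  show "min (gv wt f) (gv wt g) \<le> gv wt (f + g)" by (rule gval_add_ge)
  show "gv wt (f * g) = gv wt f + gv wt g"
  proof (cases "f = 0 \<or> g = 0")
    case True
    then show ?thesis
      using gval_eq_infinity_iff[of wt 0] gval_not_MInfty[of wt] by auto
  qed (auto intro: gval_mult_nonzero)
qed

end


section \<open>Fresh variables\<close>

definition mvar :: "nat \<times> nat \<Rightarrow> 'a::comm_ring_1 mpoly" where
  "mvar J = Poly_Mapping.single (Poly_Mapping.single J 1) 1"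

lemma mpoly_vars_zero [simp]: "mpoly_vars 0 = {}"
  by (simp add: mpoly_vars_def)

lemma mpoly_vars_mvar: "mpoly_vars (mvar J) = {J}"
  by (simp add: mpoly_vars_def mvar_def)

lemma mpoly_vars_add: "mpoly_vars (f + g) \<subseteq> mpoly_vars f \<union> mpoly_vars g"
  using keys_add[of f g] unfolding mpoly_vars_def by blast

lemma mpoly_vars_diff:
  fixes f g :: "'a::ab_group_add mpoly"
  shows "mpoly_vars (f - g) \<subseteq> mpoly_vars f \<union> mpoly_vars g"
proof -
  have "Poly_Mapping.keys (f - g) \<subseteq> Poly_Mapping.keys f \<union> Poly_Mapping.keys g"
    by (auto simp: in_keys_iff lookup_minus)
  then show ?thesis unfolding mpoly_vars_def by blast
qed

lemma mpoly_vars_sum: "mpoly_vars (sum f A) \<subseteq> (\<Union>i\<in>A. mpoly_vars (f i))"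
proof (induction A rule: infinite_finite_induct)
  case (insert i A)
  then show ?case using mpoly_vars_add[of "f i" "sum f A"] by auto
qed auto

lemma mpoly_vars_mult:
  fixes f g :: "'a::comm_ring_1 mpoly"
  shows "mpoly_vars (f * g) \<subseteq> mpoly_vars f \<union> mpoly_vars g"
proof
  fix J assume "J \<in> mpoly_vars (f * g)"
  then obtain u where "u \<in> Poly_Mapping.keys (f * g)" "J \<in> Poly_Mapping.keys u"
    unfolding mpoly_vars_def by blast
  then obtain l m where "l \<in> Poly_Mapping.keys f" "m \<in> Poly_Mapping.keys g"
    "J \<in> Poly_Mapping.keys (l + m)"
    using keys_mult[of f g] by blast
  then show "J \<in> mpoly_vars f \<union> mpoly_vars g"
    using keys_add[of l m] unfolding mpoly_vars_def by blast
qed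

lemma mpoly_eval_mvar: "mpoly_eval (mvar J) x = x J"
  by (simp add: mvar_def mpoly_eval_single monom_eval_def)

context ring_valuation
begin

lemma gval_mvar: "gv wt (mvar J) = ereal (wt J)"
  by (simp add: mvar_def gval_single one wdot_single)

text \<open>One summand avoids \<open>J\<close> and every monomial of the other contains it, so the
  supports are disjoint. Both lifting steps obtain their exact values from this.\<close>

lemma gval_add_fresh:
  assumes "J \<notin> mpoly_vars f"
  shows "gv wt (f + mvar J * g) = min (gv wt f) (ereal (wt J) + gv wt g)"
proof -
  have "Poly_Mapping.keys f \<inter> Poly_Mapping.keys (mvar J * g) = {}"
  proof (rule ccontr)
    assume "\<not> ?thesis"
    then obtain u where u: "u \<in> Poly_Mapping.keys f" "u \<in> Poly_Mapping.keys (mvar J * g)"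
      by blast
    then obtain m where "u = Poly_Mapping.single J 1 + m"
      using keys_mult[of "mvar J" g] by (auto simp: mvar_def)
    then have "J \<in> Poly_Mapping.keys u"
      by (simp add: in_keys_iff lookup_add)
    then show False
      using u(1) assms unfolding mpoly_vars_def by blast
  qed
  then have "gv wt (f + mvar J * g) = min (gv wt f) (gv wt (mvar J * g))"
    by (rule gval_add_disjoint)
  then show ?thesis
    by (simp add: ring_valuation.mult[OF ring_valuation_gval] gval_mvar)
qed

end


section \<open>Lifting tropical Pluecker vectors of rank two\<close>

definition min_twice :: "ereal \<Rightarrow> ereal \<Rightarrow> ereal \<Rightarrow> bool" where
  "min_twice a b c \<longleftrightarrow> a = b \<and> a \<le> c \<or> a = c \<and> a \<le> b \<or> b = c \<and> b \<le> a"

lemma min_twice_iff: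
  "min_twice a b c \<longleftrightarrow> (let m = min a (min b c) in
    (a = m \<and> b = m) \<or> (a = m \<and> c = m) \<or> (b = m \<and> c = m))"
  by (auto simp: min_twice_def min_def Let_def)

lemma min_twice_infinity: "min_twice a \<infinity> c \<Longrightarrow> a = c"
  by (auto simp: min_twice_def)

text \<open>The isosceles property of an ultrametric, with larger values meaning closer: the value
  of a new point against any other is determined by its nearest neighbour.\<close>

lemma min_twice_eq_min:
  assumes "min_twice a b c" "b \<le> a"
  shows "min c a = b"
  using assms unfolding min_twice_def by (auto simp: min_def)

context ring_valuation
begin

text \<open>Each point is placed next to the closest one among its predecessors, at a
  distance given by a fresh variable.\<close>

lemma ultrametric_lift:
  fixes \<delta> :: "nat \<Rightarrow> nat \<Rightarrow> ereal"
  assumes sym: "\<And>i j. i \<in> S \<Longrightarrow> j \<in> S \<Longrightarrow> \<delta> i j = \<delta> j i"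
    and diag: "\<And>i. i \<in> S \<Longrightarrow> \<delta> i i = \<infinity>"
    and not_MInf: "\<And>i j. i \<in> S \<Longrightarrow> j \<in> S \<Longrightarrow> \<delta> i j \<noteq> -\<infinity>"
    and ultra: "\<And>i j k. i \<in> S \<Longrightarrow> j \<in> S \<Longrightarrow> k \<in> S \<Longrightarrow> min_twice (\<delta> i j) (\<delta> i k) (\<delta> j k)"
    and wt: "\<And>k. k \<in> S \<Longrightarrow> wt (0, k) = real_of_ereal (Max (\<delta> k ` {j\<in>S. j < k}))"
  shows "\<exists>x. \<forall>i\<in>S. i < N \<longrightarrow> mpoly_vars (x i) \<subseteq> {0} \<times> {..<N} \<and>
    (\<forall>j\<in>S. j < N \<longrightarrow> gv wt (x i - x j) = \<delta> i j)"
proof (induction N)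
  case (Suc N)
  interpret G: ring_valuation "gv wt" by (rule ring_valuation_gval)
  obtain x where vars: "\<And>i. i \<in> S \<Longrightarrow> i < N \<Longrightarrow> mpoly_vars (x i) \<subseteq> {0} \<times> {..<N}"
    and x: "\<And>i j. i \<in> S \<Longrightarrow> i < N \<Longrightarrow> j \<in> S \<Longrightarrow> j < N \<Longrightarrow> gv wt (x i - x j) = \<delta> i j"
    using Suc by blast
  have mono: "{0} \<times> {..<N} \<subseteq> {0::nat} \<times> {..<Suc N}" by auto
  have step: ?case if y: "mpoly_vars y \<subseteq> {0} \<times> {..<Suc N}"
    "\<And>i. N \<in> S \<Longrightarrow> i \<in> S \<Longrightarrow> i < N \<Longrightarrow> gv wt (y - x i) = \<delta> N i" for y
  proof (intro exI[of _ "x(N := y)"] ballI impI conjI)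
    fix i assume i: "i \<in> S" "i < Suc N"
    show "mpoly_vars ((x(N := y)) i) \<subseteq> {0} \<times> {..<Suc N}"
      using i vars[of i] y(1) mono by (cases "i = N") (auto simp: less_Suc_eq)
    fix j assume j: "j \<in> S" "j < Suc N"
    show "gv wt ((x(N := y)) i - (x(N := y)) j) = \<delta> i j"
    proof (cases "i = N"; cases "j = N")
      assume "i \<noteq> N" "j = N"
      then show ?thesis
        using y(2)[of i] i j sym[of N i] G.minus[of "y - x i"] by simp
    qed (use i j y(2)[of j] x[of i j] diag in \<open>simp_all add: G.zero\<close>)
  qed
  show ?case
  proof (cases "N \<in> S \<and> {j\<in>S. j < N} \<noteq> {}")
    case False
    \<comment> \<open>No distance from \<open>N\<close> to an earlier point of \<open>S\<close> is
      prescribed, so any polynomial would do.\<close>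
    then show ?thesis by (intro step[of 0]) auto
  next
    case True
    then have N: "N \<in> S" by simp
    let ?P = "{j\<in>S. j < N}"
    have fin: "finite (\<delta> N ` ?P)" by simp
    then have "Max (\<delta> N ` ?P) \<in> \<delta> N ` ?P"
      using True by (intro Max_in) auto
    then obtain j where j: "j \<in> S" "j < N" "\<delta> N j = Max (\<delta> N ` ?P)" by force
    have near: "\<delta> N i \<le> \<delta> N j" if "i \<in> S" "i < N" for i
      using that fin unfolding j(3) by (intro Max_ge) auto
    show ?thesis
    \<comment> \<open>At \<infinity> the points \<open>N\<close> and \<open>j\<close> coincide and
      the lift of \<open>j\<close> is reused, as no variable has infinite weight.\<close>
    proof (cases "\<delta> N j = \<infinity>")
      case True
      show ?thesis
      proof (rule step)
        show "mpoly_vars (x j) \<subseteq> {0} \<times> {..<Suc N}" using vars[of j] j mono by blast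
        fix i assume i: "i \<in> S" "i < N"
        have "min_twice (\<delta> N i) (\<delta> N j) (\<delta> i j)" using i j N by (intro ultra)
        then have "\<delta> N i = \<delta> i j" using min_twice_infinity True by metis
        then show "gv wt (x j - x i) = \<delta> N i" using x i j sym by metis
      qed
    next
      case False
      then have wN: "ereal (wt (0, N)) = \<delta> N j"
        using wt[OF N] not_MInf[of N j] N j(1) unfolding j(3)[symmetric]
        by (cases "\<delta> N j") auto
      show ?thesis
      proof (rule step)
        show "mpoly_vars (x j + mvar (0, N)) \<subseteq> {0} \<times> {..<Suc N}"
          using vars[of j] j mono mpoly_vars_add[of "x j" "mvar (0, N)"] mpoly_vars_mvar[of "(0, N)"]
          by fastforce
        fix i assume i: "i \<in> S" "i < N"
        have "(0, N) \<notin> mpoly_vars (x j - x i)"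
          using vars[of i] vars[of j] i j mpoly_vars_diff[of "x j" "x i"] by fastforce
        then have "gv wt (x j - x i + mvar (0, N) * 1) = min (gv wt (x j - x i)) (\<delta> N j)"
          using gval_add_fresh[of "(0, N)" "x j - x i" wt 1] by (simp add: wN G.one)
        also have "gv wt (x j - x i) = \<delta> i j"
          using x[of j i] sym[of i j] i j(1,2) by simp
        also have "min (\<delta> i j) (\<delta> N j) = \<delta> N i"
          using ultra[OF N j(1) i(1)] sym[OF i(1) j(1)] near[OF i]
          by (intro min_twice_eq_min) simp_all
        finally show "gv wt (x j + mvar (0, N) - x i) = \<delta> N i"
          by (simp add: algebra_simps)
      qed
    qed
  qed
qed simp

text \<open>With \<open>p\<close> the Pluecker vector of the rows \<open>v\<close> and \<open>w\<close>: normalising \<open>w a = 0\<close>, the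
  indices \<open>i\<close> that are not parallel to \<open>a\<close> satisfy \<open>p i j = w i * w j * (x i - x j)\<close> for
  \<open>x = v / w\<close>, so that the three-term relations through \<open>a\<close> turn \<open>M\<close> into an ultrametric.\<close>

lemma tropical_pluecker_lift:
  fixes M :: "nat \<Rightarrow> nat \<Rightarrow> ereal"
  assumes "finite I" "a \<in> I" "b \<in> I" and ab: "M a b \<noteq> \<infinity>"
    and sym: "\<And>i j. M i j = M j i" and diag: "\<And>i. M i i = \<infinity>"
    and not_MInf: "\<And>i j. i \<in> I \<Longrightarrow> j \<in> I \<Longrightarrow> M i j \<noteq> -\<infinity>"
    and three_term: "\<And>i j k l. i \<in> I \<Longrightarrow> j \<in> I \<Longrightarrow> k \<in> I \<Longrightarrow> l \<in> I \<Longrightarrow>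
      min_twice (M i j + M k l) (M i k + M j l) (M i l + M j k)"
  obtains v w wt where
    "\<forall>i\<in>I. mpoly_vars (v i) \<union> mpoly_vars (w i) \<subseteq> {0, 1} \<times> UNIV"
    "\<forall>i\<in>I. \<forall>j\<in>I. gv wt (v i * w j - v j * w i) = M i j"
proof -
  define S where "S = {i\<in>I. M a i \<noteq> \<infinity>}"
  define \<delta> where "\<delta> i j = M i j - M a i - M a j" for i j
  \<comment> \<open>In \<open>S\<close>, \<open>(1, k)\<close> lifts \<open>w k\<close>, whose value
    must be \<open>M a k\<close> as \<open>w a = 0\<close> and \<open>v a\<close> has value 0.
    Outside \<open>S\<close>, \<open>w k = 0\<close> and \<open>v k * w b\<close> must have value
    \<open>M k b\<close>, where \<open>w b\<close> has value \<open>M a b\<close>.\<close>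
  define wt :: "nat \<times> nat \<Rightarrow> real" where
    "wt = (\<lambda>(c, k). if c = 0 then real_of_ereal (Max (\<delta> k ` {j\<in>S. j < k}))
      else if k \<in> S then real_of_ereal (M a k) else real_of_ereal (M k b - M a b))"
  interpret G: ring_valuation "gv wt" by (rule ring_valuation_gval)
  have SI: "i \<in> I" if "i \<in> S" for i using that by (simp add: S_def)
  have S: "\<exists>r. M a i = ereal r" if "i \<in> S" for i
    using that not_MInf[of a i] \<open>a \<in> I\<close> by (cases "M a i") (auto simp: S_def)
  have MI: "M i j \<noteq> -\<infinity>" if "i \<in> S" "j \<in> S" for i j
    using that SI not_MInf by blast
  obtain r where r: "M a b = ereal r"
    using ab not_MInf[of a b] \<open>a \<in> I\<close> \<open>b \<in> I\<close> by (cases "M a b") auto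
  obtain N where N: "I \<subseteq> {..<N}"
    using \<open>finite I\<close> finite_nat_iff_bounded by blast
  have "\<exists>x. \<forall>i\<in>S. i < N \<longrightarrow> mpoly_vars (x i) \<subseteq> {0} \<times> {..<N} \<and>
    (\<forall>j\<in>S. j < N \<longrightarrow> gv wt (x i - x j) = \<delta> i j)"
  proof (rule ultrametric_lift)
    fix i j assume ij: "i \<in> S" "j \<in> S"
    obtain s t where st: "M a i = ereal s" "M a j = ereal t"
      using S ij by blast
    show "\<delta> i j = \<delta> j i"
      using st by (cases "M i j") (auto simp: \<delta>_def sym[of j i])
    show "\<delta> i j \<noteq> -\<infinity>"
      using st MI[OF ij] by (cases "M i j") (auto simp: \<delta>_def)
    show "\<delta> i i = \<infinity>"
      using st diag by (simp add: \<delta>_def)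
    fix k assume k: "k \<in> S"
    obtain u where u: "M a k = ereal u" using S k by blast
    \<comment> \<open>Subtracting \<open>M a i + M a j + M a k\<close> from all three terms turns
      them into values of \<open>\<delta>\<close>.\<close>
    have "min_twice (M a i + M j k) (M a j + M i k) (M a k + M i j)"
      using three_term[of a i j k] SI ij k \<open>a \<in> I\<close> by simp
    then show "min_twice (\<delta> i j) (\<delta> i k) (\<delta> j k)"
      unfolding \<delta>_def min_twice_def st u
      using MI[OF ij] MI[OF ij(1) k] MI[OF ij(2) k]
      by (cases "M i j"; cases "M i k"; cases "M j k") auto
  qed (simp add: wt_def)
  then obtain x where vars: "\<And>i. i \<in> S \<Longrightarrow> mpoly_vars (x i) \<subseteq> {0} \<times> {..<N}"
    and x: "\<And>i j. i \<in> S \<Longrightarrow> j \<in> S \<Longrightarrow> gv wt (x i - x j) = \<delta> i j"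
    using N SI by blast
  define w where "w i = (if i \<in> S then mvar (1, i) else 0 :: 'r mpoly)" for i
  define v where "v i = (if i \<in> S then mvar (1, i) * x i
    else if M i b = \<infinity> then 0 else mvar (1, i) :: 'r mpoly)" for i
  have wtS: "ereal (wt (1, i)) = M a i" if "i \<in> S" for i
    using S[OF that] that by (auto simp: wt_def)
  have mixed: "gv wt (v i * w j - v j * w i) = M i j" if ij: "i \<in> I" "i \<notin> S" "j \<in> S" for i j
  proof -
    obtain s where s: "M a j = ereal s" using S ij(3) by blast
    have "M a i = \<infinity>" using ij by (simp add: S_def)
    moreover have "min_twice (M a b + M i j) (M a i + M b j) (M a j + M b i)"
      using three_term[of a b i j] SI ij \<open>a \<in> I\<close> \<open>b \<in> I\<close> by simp
    moreover have "M b j \<noteq> -\<infinity>" using not_MInf SI ij \<open>b \<in> I\<close> by blast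
    \<comment> \<open>The middle term is infinite, so the outer two agree: column \<open>i\<close>
      behaves like a multiple of column \<open>a\<close>, by a factor of value
      \<open>M i b - M a b\<close>, or like a zero column.\<close>
    ultimately have eq: "ereal r + M i j = ereal s + M i b"
      using min_twice_infinity r s sym[of b i] by (metis ereal_plus_eq_PInfty)
    show ?thesis
    proof (cases "M i b = \<infinity>")
      case True
      then have "M i j = \<infinity>" using eq by simp
      then show ?thesis using True ij by (simp add: v_def w_def G.zero)
    next
      case False
      then obtain c where c: "M i b = ereal c"
        using not_MInf[of i b] ij \<open>b \<in> I\<close> by (cases "M i b") auto
      have "gv wt (v i * w j - v j * w i) = ereal (c - r) + ereal s"
        using c r s ij False wtS[OF ij(3)]
        by (simp add: v_def w_def G.mult gval_mvar) (simp add: wt_def)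
      also have "\<dots> = M i j"
        using eq c by (cases "M i j") auto
      finally show ?thesis .
    qed
  qed
  show ?thesis
  proof (rule that[of v w wt]; intro ballI)
    fix i assume i: "i \<in> I"
    show "mpoly_vars (v i) \<union> mpoly_vars (w i) \<subseteq> {0, 1} \<times> UNIV"
    proof -
      have "mpoly_vars (mvar (1, i) :: 'r mpoly) \<subseteq> {0, 1} \<times> UNIV"
        by (simp add: mpoly_vars_mvar)
      moreover from this have "mpoly_vars (mvar (1, i) * x i) \<subseteq> {0, 1} \<times> UNIV" if "i \<in> S"
        using vars[OF that] mpoly_vars_mult[of "mvar (1, i)" "x i"] by blast
      ultimately show ?thesis by (simp add: v_def w_def)
    qed
    fix j assume j: "j \<in> I"
    consider "i \<in> S" "j \<in> S" | "i \<notin> S" "j \<in> S" | "i \<in> S" "j \<notin> S" | "i \<notin> S" "j \<notin> S"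
      by blast
    then show "gv wt (v i * w j - v j * w i) = M i j"
    proof cases
      case 1
      have "v i * w j - v j * w i = mvar (1, i) * mvar (1, j) * (x i - x j)"
        using 1 by (simp add: v_def w_def algebra_simps)
      then have "gv wt (v i * w j - v j * w i) = M a i + M a j + \<delta> i j"
        using 1 by (simp only: G.mult gval_mvar wtS x)
      also have "\<dots> = M i j"
        using S[OF 1(1)] S[OF 1(2)] MI[OF 1] by (cases "M i j") (auto simp: \<delta>_def)
      finally show ?thesis .
    next
      case 2
      then show ?thesis using mixed i by blast
    next
      case 3
      then have "gv wt (v j * w i - v i * w j) = M j i" using mixed j by blast
      then show ?thesis using G.minus[of "v j * w i - v i * w j"] sym by simp
    next
      case 4
      then have "M a i = \<infinity>" "M a j = \<infinity>" using i j by (simp_all add: S_def)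
      moreover have "min_twice (M a b + M i j) (M a i + M b j) (M a j + M b i)"
        using three_term[of a b i j] i j \<open>a \<in> I\<close> \<open>b \<in> I\<close> by simp
      moreover have "M b j \<noteq> -\<infinity>" "M b i \<noteq> -\<infinity>"
        using not_MInf i j \<open>b \<in> I\<close> by blast+
      ultimately have "min_twice (ereal r + M i j) \<infinity> \<infinity>"
        using r by simp
      then have "M i j = \<infinity>"
        by (cases "M i j") (auto simp: min_twice_def)
      then show ?thesis using 4 by (simp add: w_def G.zero)
    qed
  qed
qed

end


section \<open>Imposing the symplectic relation\<close>

lemma symp_form_eq_sum_pluecker:
  "symp_form n v w = (\<Sum>i=1..n. pluecker_vec v w (i, bar n i))"
  by (simp add: symp_form_def pluecker_vec_def)

context ring_valuation
begin

text \<open>Every index occurs in exactly one term of the symplectic relation, so rescaling the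
  coordinates \<open>i0\<close> and \<open>j0\<close> where the minimum is attained makes the form vanish. The fresh
  variable \<open>(2, 0)\<close> of weight \<open>0\<close> prevents cancellation among the remaining terms, and
  \<open>(2, 1)\<close> compensates for the denominator \<open>p (i0, bar i0)\<close> that has been cleared.\<close>

lemma symplectic_rescaling:
  fixes v w :: "nat \<Rightarrow> 'r mpoly"
  defines "p \<equiv> pluecker_vec v w"
  assumes vars: "\<And>i. i \<in> {1..2 * n} \<Longrightarrow> mpoly_vars (v i) \<union> mpoly_vars (w i) \<subseteq> {0, 1} \<times> UNIV"
    and ij: "i0 \<in> {1..n}" "j0 \<in> {1..n}" "i0 \<noteq> j0"
    and min: "gv wt (p (i0, bar n i0)) = ereal r" "gv wt (p (j0, bar n j0)) = ereal r"
      "\<And>i. i \<in> {1..n} \<Longrightarrow> ereal r \<le> gv wt (p (i, bar n i))"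
  obtains v' w' wt' where "symp_form n v' w' = 0"
    "\<forall>J\<in>pidx n. gv wt' (pluecker_vec v' w' J) = gv wt (p J)"
proof -
  \<comment> \<open>Each coordinate will be multiplied by \<open>Z * s i * s j\<close> with every
    \<open>s i\<close> of value \<open>r\<close>, so \<open>Z\<close> needs value
    \<open>- 2 * r\<close>.\<close>
  define wt' where "wt' = wt((2, 0) := 0, (2, 1) := - 2 * r)"
  interpret G: ring_valuation "gv wt'" by (rule ring_valuation_gval)
  define q where "q i = p (i, bar n i)" for i
  define Y Z :: "'r mpoly" where "Y = mvar (2, 0)" and "Z = mvar (2, 1)"
  define R where "R = (\<Sum>i\<in>{1..n} - {i0, j0}. q i)"
  \<comment> \<open>Up to the common factor \<open>q i0\<close>: scale \<open>j0\<close> by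
    \<open>Y\<close>, keep the others, and solve the linear relation for the factor at
    \<open>i0\<close>.\<close>
  define s where "s i = (if i = i0 then - (R + Y * q j0) else if i = j0 then Y * q i0 else q i0)" for i
  define v' where "v' i = s i * v i" for i
  define w' where "w' i = Z * s i * w i" for i
  have p_vars: "mpoly_vars (p (i, j)) \<subseteq> {0, 1} \<times> UNIV" if "i \<in> {1..2*n}" "j \<in> {1..2*n}" for i j
    using vars[OF that(1)] vars[OF that(2)] mpoly_vars_diff[of "v i * w j" "v j * w i"]
      mpoly_vars_mult[of "v i" "w j"] mpoly_vars_mult[of "v j" "w i"]
    unfolding p_def pluecker_vec_def case_prod_conv by blast
  have gv_p: "gv wt' (p (i, j)) = gv wt (p (i, j))" if "i \<in> {1..2*n}" "j \<in> {1..2*n}" for i j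
    by (rule gval_cong) (use p_vars[OF that] in \<open>auto simp: wt'_def\<close>)
  have bar: "i \<in> {1..2*n}" "bar n i \<in> {1..2*n}" if "i \<in> {1..n}" for i
    using that by (auto simp: bar_def)
  have gv_q: "gv wt' (q i) = gv wt (p (i, bar n i))" if "i \<in> {1..n}" for i
    unfolding q_def using bar[OF that] by (rule gv_p)
  have gv_YZ: "gv wt' Y = 0" "gv wt' Z = ereal (- 2 * r)"
    by (simp_all add: Y_def Z_def gval_mvar wt'_def zero_ereal_def)
  have "mpoly_vars R \<subseteq> (\<Union>i\<in>{1..n} - {i0, j0}. mpoly_vars (q i))"
    unfolding R_def by (rule mpoly_vars_sum)
  also have "\<dots> \<subseteq> {0, 1} \<times> UNIV"
    unfolding q_def by (intro UN_least p_vars bar) auto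
  finally have "(2, 0) \<notin> mpoly_vars R" by auto
  then have "gv wt' (R + Y * q j0) = min (gv wt' R) (ereal r)"
    using gv_q[OF ij(2)] min(2) unfolding Y_def
    by (simp add: gval_add_fresh) (simp add: wt'_def)
  also have "\<dots> = ereal r"
    unfolding R_def using min(3) gv_q by (intro min.absorb2 G.sum_ge) auto
  finally have gv_s: "gv wt' (s i) = ereal r" for i
    using gv_q[OF ij(1)] min(1) gv_YZ by (simp add: s_def G.minus G.mult del: minus_add_distrib)
  have pl: "pluecker_vec v' w' (i, j) = Z * s i * s j * p (i, j)" for i j
    by (simp add: pluecker_vec_def v'_def w'_def p_def algebra_simps)
  show ?thesis
  proof (rule that[of v' w' wt']; (intro ballI)?)
    fix J assume "J \<in> pidx n"
    then obtain i j where J: "J = (i, j)" "i \<in> {1..2*n}" "j \<in> {1..2*n}"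
      by (auto simp: pidx_def)
    have "gv wt' (pluecker_vec v' w' J) = ereal (- 2 * r) + ereal r + ereal r + gv wt (p J)"
      using J by (simp only: pl G.mult gv_YZ gv_s gv_p)
    then show "gv wt' (pluecker_vec v' w' J) = gv wt (p J)"
      by (simp flip: zero_ereal_def)
  next
    \<comment> \<open>A barred index exceeds \<open>n\<close>, so it is neither \<open>i0\<close>
      nor \<open>j0\<close> and its factor is \<open>q i0\<close>.\<close>
    have "symp_form n v' w' = (\<Sum>i=1..n. Z * q i0 * (s i * q i))"
      unfolding symp_form_eq_sum_pluecker pl
      by (rule sum.cong) (use ij in \<open>auto simp: s_def q_def bar_def\<close>)
    also have "\<dots> = Z * q i0 * (\<Sum>i=1..n. s i * q i)"
      by (simp add: sum_distrib_left)
    also have "(\<Sum>i=1..n. s i * q i) = s i0 * q i0 + (\<Sum>i\<in>{1..n} - {i0}. s i * q i)"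
      using ij by (intro sum.remove) auto
    also have "(\<Sum>i\<in>{1..n} - {i0}. s i * q i) = s j0 * q j0 + (\<Sum>i\<in>{1..n} - {i0} - {j0}. s i * q i)"
      using ij by (intro sum.remove) auto
    also have "{1..n} - {i0} - {j0} = {1..n} - {i0, j0}"
      by blast
    also have "(\<Sum>i\<in>{1..n} - {i0, j0}. s i * q i) = q i0 * R"
      unfolding R_def sum_distrib_left by (rule sum.cong) (auto simp: s_def)
    also have "s i0 * q i0 + (s j0 * q j0 + q i0 * R) = 0"
      using ij(3) by (simp add: s_def algebra_simps)
    finally show "symp_form n v' w' = 0" by simp
  qed
qed

end

text \<open>Insertion sort by adjacent transpositions: \<open>last\<close> inserts the fourth
  argument into a sorted triple, \<open>third\<close> the third into a sorted pair.\<close>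

lemma linorder_wlog4:
  fixes T :: "'a::linorder \<Rightarrow> 'a \<Rightarrow> 'a \<Rightarrow> 'a \<Rightarrow> bool"
  assumes sorted: "\<And>i j k l. i \<le> j \<Longrightarrow> j \<le> k \<Longrightarrow> k \<le> l \<Longrightarrow> T i j k l"
    and swap: "\<And>i j k l. T i j k l \<Longrightarrow> T j i k l" "\<And>i j k l. T i j k l \<Longrightarrow> T i k j l"
      "\<And>i j k l. T i j k l \<Longrightarrow> T i j l k"
  shows "T i j k l"
proof -
  have last: "T i j k l" if "i \<le> j" "j \<le> k" for i j k l
    using that sorted[of i j k l] sorted[of i j l k] sorted[of i l j k] sorted[of l i j k] swap
    by (metis linear)
  have third: "T i j k l" if "i \<le> j" for i j k l
    using that last[of i j k l] last[of i k j l] last[of k i j l] swap by (metis linear)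
  show ?thesis
    using third[of i j k l] third[of j i k l] swap(1) by (metis linear)
qed

section \<open>Lifting a point of \<open>SpDr n\<close>\<close>

context ring_valuation
begin

lemma SpDr_lift:
  assumes "\<mu> \<in> SpDr n"
  obtains v w wt where "symp_form n v w = 0"
    "\<forall>J\<in>pidx n. gv wt (pluecker_vec v w J) = \<mu> J"
proof -
  \<comment> \<open>The tropical shadow of a skew-symmetric matrix: symmetric, with \<infinity> on
    the diagonal.\<close>
  define M where "M i j = (if i < j then \<mu> (i, j) else if j < i then \<mu> (j, i) else \<infinity>)" for i j
  have not_MInf: "M i j \<noteq> -\<infinity>" if "i \<in> {1..2*n}" "j \<in> {1..2*n}" for i j
    using assms that unfolding SpDr_def tp_point_def by (auto simp: M_def pidx_def)
  have sym: "M i j = M j i" for i j by (simp add: M_def)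
  have diag: "M i i = \<infinity>" for i by (simp add: M_def)
  have sorted: "min_twice (M i j + M k l) (M i k + M j l) (M i l + M j k)"
    if "1 \<le> i" "i < j" "j < k" "k < l" "l \<le> 2 * n" for i j k l
    using assms that unfolding SpDr_def min_twice_iff Let_def by (simp add: M_def)
  define T where "T i j k l = min_twice (M i j + M k l) (M i k + M j l) (M i l + M j k)" for i j k l
  have swap: "T i j k l \<Longrightarrow> T j i k l" "T i j k l \<Longrightarrow> T i k j l" "T i j k l \<Longrightarrow> T i j l k" for i j k l
    unfolding T_def min_twice_def by (auto simp: sym add.commute)
  \<comment> \<open>With a repeated index one term is infinite and the other two coincide.\<close>
  have eq: "T i i k l" if "k \<in> {1..2*n}" "l \<in> {1..2*n}" for i k l
    using not_MInf[OF that] unfolding T_def min_twice_def by (simp add: diag add.commute)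
  have le: "T i j k l" if ijkl: "1 \<le> i" "i \<le> j" "j \<le> k" "k \<le> l" "l \<le> 2 * n" for i j k l
  proof -
    consider "i = j" | "j = k" | "k = l" | "i < j" "j < k" "k < l"
      using ijkl by linarith
    then show ?thesis
    proof cases
      case 1
      then show ?thesis using eq ijkl by simp
    next
      case 2
      have "T j j i l" using eq ijkl by simp
      then show ?thesis using 2 swap by metis
    next
      case 3
      have "T k k i j" using eq ijkl by simp
      then have "T i k k j" using swap by metis
      then show ?thesis using 3 swap by metis
    next
      case 4
      then show ?thesis using sorted[of i j k l] ijkl unfolding T_def by simp
    qed
  qed
  have three_term: "T i j k l"
    if "i \<in> {1..2*n}" "j \<in> {1..2*n}" "k \<in> {1..2*n}" "l \<in> {1..2*n}" for i j k l
  proof -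
    \<comment> \<open>The range conditions sit inside the predicate so that it is stable under the
      swaps.\<close>
    have "i \<in> {1..2*n} \<longrightarrow> j \<in> {1..2*n} \<longrightarrow> k \<in> {1..2*n} \<longrightarrow> l \<in> {1..2*n} \<longrightarrow> T i j k l"
      by (rule linorder_wlog4[where T = "\<lambda>i j k l. i \<in> {1..2*n} \<longrightarrow> j \<in> {1..2*n} \<longrightarrow>
          k \<in> {1..2*n} \<longrightarrow> l \<in> {1..2*n} \<longrightarrow> T i j k l"]) (auto intro: le swap)
    with that show ?thesis by blast
  qed
  obtain a b where ab: "a \<in> {1..2*n}" "b \<in> {1..2*n}" "M a b \<noteq> \<infinity>"
  proof -
    obtain J where J: "J \<in> pidx n" "\<mu> J \<noteq> \<infinity>"
      using assms unfolding SpDr_def tp_point_def by blast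
    obtain i j where ij: "J = (i, j)" by (cases J)
    then show ?thesis using that[of i j] J by (auto simp: M_def pidx_def)
  qed
  obtain v w wt
    where vars: "\<forall>i\<in>{1..2*n}. mpoly_vars (v i) \<union> mpoly_vars (w i) \<subseteq> {0, 1} \<times> UNIV"
    and lift: "\<forall>i\<in>{1..2*n}. \<forall>j\<in>{1..2*n}. gv wt (v i * w j - v j * w i) = M i j"
    by (rule tropical_pluecker_lift[OF finite_atLeastAtMost ab sym diag not_MInf
          three_term[unfolded T_def]])
  have pl: "gv wt (pluecker_vec v w J) = \<mu> J" if J: "J \<in> pidx n" for J
    using J lift by (auto simp: pidx_def pluecker_vec_def M_def)
  have bar: "(i, bar n i) \<in> pidx n" if "i \<in> {1..n}" for i
    using that by (auto simp: pidx_def bar_def)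
  define m where "m = Min ((\<lambda>i. \<mu> (i, bar n i)) ` {1..n})"
  have m_le: "m \<le> \<mu> (i, bar n i)" if "i \<in> {1..n}" for i
    unfolding m_def using that by (intro Min_le) auto
  consider "m = \<infinity>" | i j where "i \<in> {1..n}" "j \<in> {1..n}" "i \<noteq> j" "\<mu> (i, bar n i) = m"
    "\<mu> (j, bar n j) = m" "m \<noteq> \<infinity>"
    using assms unfolding SpDr_def Let_def m_def by blast
  then show ?thesis
  proof cases
    case 1
    \<comment> \<open>Value \<infinity> forces the zero polynomial, so the unscaled lift is already
      isotropic.\<close>
    have "pluecker_vec v w (i, bar n i) = 0" if "i \<in> {1..n}" for i
      using pl[OF bar[OF that]] m_le[OF that] 1 by (simp add: gval_eq_infinity_iff)
    then have "symp_form n v w = 0"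
      unfolding symp_form_eq_sum_pluecker by simp
    then show ?thesis using pl by (intro that[of v w wt]) simp_all
  next
    case (2 i j)
    have "m \<noteq> -\<infinity>"
      using 2 bar[OF 2(1)] assms unfolding SpDr_def tp_point_def by auto
    with 2 obtain r where r: "m = ereal r" by (cases m) auto
    have min: "gv wt (pluecker_vec v w (i, bar n i)) = ereal r"
      "gv wt (pluecker_vec v w (j, bar n j)) = ereal r"
      using pl bar 2 r by simp_all
    have min_le: "ereal r \<le> gv wt (pluecker_vec v w (k, bar n k))" if "k \<in> {1..n}" for k
      using pl bar m_le r that by simp
    obtain v' w' wt' where "symp_form n v' w' = 0"
      "\<forall>J\<in>pidx n. gv wt' (pluecker_vec v' w' J) = gv wt (pluecker_vec v w J)"
      by (rule symplectic_rescaling[OF bspec[OF vars] 2(1-3) min min_le])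
    then show ?thesis using pl by (intro that[of v' w' wt']) simp_all
  qed
qed

end


section \<open>The tropical basis theorem\<close>

lemma lin_indep2_if_pluecker_nonzero:
  fixes v w :: "nat \<Rightarrow> 'a::field"
  assumes "(i, j) \<in> pidx n" "pluecker_vec v w (i, j) \<noteq> 0"
  shows "lin_indep2 n v w"
  unfolding lin_indep2_def
proof (intro allI impI)
  fix a b assume ab: "\<forall>i\<in>{1..2*n}. a * v i + b * w i = 0"
  have "a * v i + b * w i = 0" "a * v j + b * w j = 0"
    using ab assms(1) by (auto simp: pidx_def)
  moreover have "a * (v i * w j - v j * w i) = (a * v i + b * w i) * w j - (a * v j + b * w j) * w i"
    "b * (v i * w j - v j * w i) = (a * v j + b * w j) * v i - (a * v i + b * w i) * v j"
    by (simp_all add: algebra_simps)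
  ultimately show "a = 0 \<and> b = 0"
    using assms(2) by (auto simp: pluecker_vec_def)
qed

text \<open>Membership in the ideal only speaks about points over the ground field; a polynomial
  identity over an infinite field extends it to points over the polynomial ring.\<close>

lemma mpoly_subst_S_ideal_eq_zero:
  fixes f :: "'a::field mpoly"
  assumes "infinite (UNIV :: 'a set)" "f \<in> S_ideal n" "symp_form n v w = 0"
    and "J \<in> pidx n" "pluecker_vec v w J \<noteq> 0"
  shows "mpoly_subst f (pluecker_vec v w) = 0"
proof -
  let ?P = "pluecker_vec v w"
  \<comment> \<open>A specialisation may make the two vectors dependent, where \<open>f\<close> need
    not vanish; but then \<open>?P J\<close> does. The factor is cancelled at the end in the
    polynomial ring, a domain.\<close>
  have "mpoly_subst f ?P * ?P J = 0"
  proof (rule mpoly_eq_zeroI[OF assms(1)])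
    fix x
    define vx wx where "vx i = mpoly_eval (v i) x" and "wx i = mpoly_eval (w i) x" for i
    have P: "(\<lambda>J. mpoly_eval (?P J) x) = pluecker_vec vx wx"
      by (auto simp: pluecker_vec_def vx_def wx_def mpoly_eval_diff mpoly_eval_mult)
    have "symp_form n vx wx = mpoly_eval (symp_form n v w) x"
      by (simp add: symp_form_def vx_def wx_def mpoly_eval_sum mpoly_eval_diff mpoly_eval_mult)
    then have symp: "symp_form n vx wx = 0" by (simp add: assms(3))
    show "mpoly_eval (mpoly_subst f ?P * ?P J) x = 0"
    proof (cases "mpoly_eval (?P J) x = 0")
      case False
      then have "pluecker_vec vx wx J \<noteq> 0"
        using P by (metis (no_types))
      then have "lin_indep2 n vx wx"
        using assms(4) lin_indep2_if_pluecker_nonzero by (cases J) blast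
      then have "mpoly_eval f (pluecker_vec vx wx) = 0"
        using assms(2) symp unfolding S_ideal_def by blast
      then show ?thesis
        by (simp add: mpoly_eval_mult mpoly_eval_mpoly_subst P)
    qed (simp add: mpoly_eval_mult)
  qed
  then show ?thesis using assms(5) by simp
qed

lemma mdot_cong:
  assumes "\<And>J. J \<in> Poly_Mapping.keys u \<Longrightarrow> x J = y J"
  shows "mdot u x = mdot u y"
  unfolding mdot_def by (rule sum.cong) (simp_all add: assms)

lemma SpDr_subset_TSpGr:
  fixes val :: "'a::field \<Rightarrow> ereal"
  assumes "alg_closed TYPE('a)" "nonarch_valuation val"
  shows "SpDr n \<subseteq> TSpGr val n"
proof
  fix \<mu> assume \<mu>: "\<mu> \<in> SpDr n"
  interpret ring_valuation val
    using assms(2) by (rule ring_valuation_of_nonarch)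
  obtain v w wt where symp: "symp_form n v w = 0"
    and lift: "\<forall>J\<in>pidx n. gv wt (pluecker_vec v w J) = \<mu> J"
    by (rule SpDr_lift[OF \<mu>])
  interpret G: ring_valuation "gv wt" by (rule ring_valuation_gval)
  let ?P = "pluecker_vec v w"
  have tp: "tp_point n \<mu>" using \<mu> by (simp add: SpDr_def)
  then obtain J where J: "J \<in> pidx n" "?P J \<noteq> 0"
    using lift G.eq_infinity_iff unfolding tp_point_def by metis
  have "trop_hyp val f \<mu>" if f: "f \<in> S_ideal n" for f :: "'a mpoly"
  proof -
    let ?term = "\<lambda>u. Poly_Mapping.single 0 (Poly_Mapping.lookup f u) * monom_eval u ?P"
    have "sum ?term (Poly_Mapping.keys f) = 0"
      using mpoly_subst_S_ideal_eq_zero[OF alg_closed_infinite[OF assms(1)] f symp J]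
      by (simp add: mpoly_subst_def)
    then have min: "(\<forall>i\<in>Poly_Mapping.keys f. gv wt (?term i) = \<infinity>) \<or>
      (\<exists>i\<in>Poly_Mapping.keys f. \<exists>j\<in>Poly_Mapping.keys f. i \<noteq> j \<and> gv wt (?term i) = gv wt (?term j) \<and>
        (\<forall>k\<in>Poly_Mapping.keys f. gv wt (?term i) \<le> gv wt (?term k)))"
      by (intro G.sum_eq_zero_min_twice) simp_all
    \<comment> \<open>Only coordinates in \<open>pidx n\<close> are lifted; \<open>u\<close>
      involves no others.\<close>
    have "gv wt (?term u) = val (Poly_Mapping.lookup f u) + mdot u \<mu>"
      if "u \<in> Poly_Mapping.keys f" for u
    proof -
      have "Poly_Mapping.keys u \<subseteq> pidx n"
        using f that by (auto simp: S_ideal_def mpoly_vars_def)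
      then have "mdot u (\<lambda>J. gv wt (?P J)) = mdot u \<mu>"
        using lift by (intro mdot_cong) auto
      then show ?thesis
        by (simp add: G.mult G.monom_eval gval_single wdot_zero flip: zero_ereal_def)
    qed
    with min show ?thesis
      unfolding trop_hyp_def Let_def by (metis (no_types, lifting))
  qed
  with tp show "\<mu> \<in> TSpGr val n" by (simp add: TSpGr_def)
qed

section \<open>The relations in the ideal and the conditions they impose\<close>

lemma mdot_single: "mdot (Poly_Mapping.single J 1) w = w J"
  by (simp add: mdot_def flip: one_ereal_def)

lemma mdot_single_add:
  assumes "J \<noteq> K"
  shows "mdot (Poly_Mapping.single J 1 + Poly_Mapping.single K 1) w = w J + w K"
proof -
  let ?u = "Poly_Mapping.single J 1 + Poly_Mapping.single K (1::nat)"
  have lookup: "Poly_Mapping.lookup ?u J = 1" "Poly_Mapping.lookup ?u K = 1"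
    using assms by (simp_all add: lookup_add lookup_single when_def)
  have "Poly_Mapping.keys ?u = {J, K}"
    using keys_add[of "Poly_Mapping.single J 1" "Poly_Mapping.single K (1::nat)"] lookup
    by (auto simp: in_keys_iff)
  then show ?thesis
    using assms lookup by (simp add: mdot_def flip: one_ereal_def)
qed

definition pluecker_rel :: "nat \<Rightarrow> nat \<Rightarrow> nat \<Rightarrow> nat \<Rightarrow> 'a::field mpoly" where
  "pluecker_rel i j k l = mvar (i, j) * mvar (k, l) - mvar (i, k) * mvar (j, l) + mvar (i, l) * mvar (j, k)"

definition symplectic_rel :: "nat \<Rightarrow> 'a::field mpoly" where
  "symplectic_rel n = (\<Sum>i=1..n. mvar (i, bar n i))"

lemma pluecker_rel_in_S_ideal:
  assumes "1 \<le> i" "i < j" "j < k" "k < l" "l \<le> 2 * n"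
  shows "pluecker_rel i j k l \<in> S_ideal n"
proof -
  let ?X = "mvar :: _ \<Rightarrow> 'a mpoly"
  have "mpoly_vars (pluecker_rel i j k l :: 'a mpoly)
      \<subseteq> {(i, j), (k, l), (i, k), (j, l), (i, l), (j, k)}"
    using mpoly_vars_add[of "?X (i, j) * ?X (k, l) - ?X (i, k) * ?X (j, l)" "?X (i, l) * ?X (j, k)"]
      mpoly_vars_diff[of "?X (i, j) * ?X (k, l)" "?X (i, k) * ?X (j, l)"]
      mpoly_vars_mult[of "?X (i, j)" "?X (k, l)"] mpoly_vars_mult[of "?X (i, k)" "?X (j, l)"]
      mpoly_vars_mult[of "?X (i, l)" "?X (j, k)"]
    unfolding pluecker_rel_def mpoly_vars_mvar by blast
  also have "\<dots> \<subseteq> pidx n"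
    using assms by (auto simp: pidx_def)
  finally show ?thesis
    by (simp add: S_ideal_def pluecker_rel_def mpoly_eval_add mpoly_eval_diff mpoly_eval_mult
        mpoly_eval_mvar pluecker_vec_def algebra_simps)
qed

lemma symplectic_rel_in_S_ideal: "symplectic_rel n \<in> S_ideal n"
proof -
  have "mpoly_vars (symplectic_rel n :: 'a mpoly) \<subseteq> (\<Union>i\<in>{1..n}. {(i, bar n i)})"
    using mpoly_vars_sum[of "\<lambda>i. mvar (i, bar n i) :: 'a mpoly" "{1..n}"]
    unfolding symplectic_rel_def mpoly_vars_mvar .
  also have "\<dots> \<subseteq> pidx n"
    by (auto simp: pidx_def bar_def)
  finally show ?thesis
    by (simp add: S_ideal_def symplectic_rel_def mpoly_eval_sum mpoly_eval_mvar
        symp_form_eq_sum_pluecker)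
qed

text \<open>The coefficients of the relations are 1 and -1, of valuation 0 in every characteristic,
  so their tropical hypersurfaces are exactly the conditions in \<open>SpDr\<close>.\<close>

lemma TSpGr_subset_SpDr:
  fixes val :: "'a::field \<Rightarrow> ereal"
  assumes "nonarch_valuation val"
  shows "TSpGr val n \<subseteq> SpDr n"
proof
  interpret ring_valuation val
    using assms by (rule ring_valuation_of_nonarch)
  fix \<mu> assume \<mu>: "\<mu> \<in> TSpGr val n"
  then have tp: "tp_point n \<mu>" and trop: "\<And>f :: 'a mpoly. f \<in> S_ideal n \<Longrightarrow> trop_hyp val f \<mu>"
    by (simp_all add: TSpGr_def)
  have pluecker: "min_twice (\<mu> (i, j) + \<mu> (k, l)) (\<mu> (i, k) + \<mu> (j, l)) (\<mu> (i, l) + \<mu> (j, k))"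
    if ijkl: "1 \<le> i" "i < j" "j < k" "k < l" "l \<le> 2 * n" for i j k l
  proof -
    define e where "e J K = Poly_Mapping.single J 1 + Poly_Mapping.single K (1::nat)"
      for J K :: "nat \<times> nat"
    let ?a = "e (i, j) (k, l)" and ?b = "e (i, k) (j, l)" and ?c = "e (i, l) (j, k)"
    let ?f = "pluecker_rel i j k l :: 'a mpoly"
    \<comment> \<open>Distinct monomials cannot merge, so the support has exactly three
      elements.\<close>
    have neq: "?a \<noteq> ?b" "?a \<noteq> ?c" "?b \<noteq> ?c"
    proof -
      have "Poly_Mapping.lookup ?a (i, j) \<noteq> Poly_Mapping.lookup ?b (i, j)"
        "Poly_Mapping.lookup ?a (i, j) \<noteq> Poly_Mapping.lookup ?c (i, j)"
        "Poly_Mapping.lookup ?b (i, k) \<noteq> Poly_Mapping.lookup ?c (i, k)"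
        using ijkl by (simp_all add: e_def lookup_add lookup_single when_def)
      then show "?a \<noteq> ?b" "?a \<noteq> ?c" "?b \<noteq> ?c" by metis+
    qed
    have "?f = Poly_Mapping.single ?a 1 - Poly_Mapping.single ?b 1 + Poly_Mapping.single ?c 1"
      by (simp add: pluecker_rel_def mvar_def mult_single e_def)
    then have lookup: "Poly_Mapping.lookup ?f u
        = (1 when ?a = u) - (1 when ?b = u) + (1 when ?c = u)" for u
      by (simp add: lookup_add lookup_minus lookup_single)
    have coeff: "Poly_Mapping.lookup ?f ?a = 1" "Poly_Mapping.lookup ?f ?b = - 1"
      "Poly_Mapping.lookup ?f ?c = 1"
      using neq by (auto simp: lookup when_def)
    have keys: "Poly_Mapping.keys ?f = {?a, ?b, ?c}"
      using neq by (auto simp: in_keys_iff lookup when_def split: if_splits)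
    have dots: "mdot ?a \<mu> = \<mu> (i, j) + \<mu> (k, l)" "mdot ?b \<mu> = \<mu> (i, k) + \<mu> (j, l)"
      "mdot ?c \<mu> = \<mu> (i, l) + \<mu> (j, k)"
      unfolding e_def by (rule mdot_single_add; use ijkl in simp)+
    have "trop_hyp val ?f \<mu>"
      using ijkl by (intro trop pluecker_rel_in_S_ideal)
    then show ?thesis
      unfolding trop_hyp_def Let_def keys min_twice_def
      by (auto simp: coeff one minus_one dots)
  qed
  have symplectic: "let m = Min ((\<lambda>i. \<mu> (i, bar n i)) ` {1..n}) in
    m = \<infinity> \<or> (\<exists>i\<in>{1..n}. \<exists>j\<in>{1..n}. i \<noteq> j \<and> \<mu> (i, bar n i) = m \<and> \<mu> (j, bar n j) = m)"
  proof -
    have n: "n > 0"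
      using tp by (auto simp: tp_point_def pidx_def)
    define e where "e i = Poly_Mapping.single (i, bar n i) (1::nat)" for i
    let ?f = "symplectic_rel n :: 'a mpoly"
    let ?t = "\<lambda>i. \<mu> (i, bar n i)"
    have inj: "e i = e j \<longleftrightarrow> i = j" for i j
    proof
      assume "e i = e j"
      then have "Poly_Mapping.keys (e i) = Poly_Mapping.keys (e j)" by simp
      then show "i = j" by (simp add: e_def)
    qed simp
    have lookup: "Poly_Mapping.lookup ?f u = (\<Sum>i=1..n. 1 when e i = u)" for u
      by (simp add: symplectic_rel_def mvar_def e_def lookup_sum lookup_single)
    have coeff: "Poly_Mapping.lookup ?f (e i) = 1" if "i \<in> {1..n}" for i
      using that by (simp add: lookup inj when_def)
    have keys: "Poly_Mapping.keys ?f = e ` {1..n}"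
    proof
      show "Poly_Mapping.keys ?f \<subseteq> e ` {1..n}"
        by (auto simp: in_keys_iff lookup when_def elim!: sum.not_neutral_contains_not_neutral
            split: if_splits)
      show "e ` {1..n} \<subseteq> Poly_Mapping.keys ?f"
        by (auto simp: in_keys_iff coeff)
    qed
    have t: "val (Poly_Mapping.lookup ?f (e i)) + mdot (e i) \<mu> = ?t i" if "i \<in> {1..n}" for i
    proof -
      have "mdot (e i) \<mu> = ?t i" unfolding e_def by (rule mdot_single)
      then show ?thesis using coeff[OF that] by (simp add: one)
    qed
    have "trop_hyp val ?f \<mu>"
      by (intro trop symplectic_rel_in_S_ideal)
    then consider "\<forall>u\<in>e ` {1..n}. val (Poly_Mapping.lookup ?f u) + mdot u \<mu> = \<infinity>"
      | u1 u2 where "u1 \<in> e ` {1..n}" "u2 \<in> e ` {1..n}" "u1 \<noteq> u2"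
        "val (Poly_Mapping.lookup ?f u1) + mdot u1 \<mu> = val (Poly_Mapping.lookup ?f u2) + mdot u2 \<mu>"
        "\<forall>u\<in>e ` {1..n}. val (Poly_Mapping.lookup ?f u1) + mdot u1 \<mu>
          \<le> val (Poly_Mapping.lookup ?f u) + mdot u \<mu>"
      unfolding trop_hyp_def Let_def keys by blast
    then show ?thesis
    proof cases
      case 1
      then have "?t i = \<infinity>" if "i \<in> {1..n}" for i
        using t[OF that] that by (metis imageI)
      then have "?t ` {1..n} = {\<infinity>}"
        using n by (auto simp: image_constant_conv)
      then show ?thesis by simp
    next
      case 2
      then obtain i j where ij: "i \<in> {1..n}" "j \<in> {1..n}" "i \<noteq> j" "u1 = e i" "u2 = e j"
        by blast
      have "?t i \<le> ?t k" if "k \<in> {1..n}" for k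
        using 2(5) ij(1,4) t that by (metis imageI)
      then have "Min (?t ` {1..n}) = ?t i"
        using ij(1) by (intro Min_eqI) auto
      moreover have "?t i = ?t j"
        using 2(4) ij t by metis
      ultimately show ?thesis using ij(1-3) unfolding Let_def by metis
    qed
  qed
  show "\<mu> \<in> SpDr n"
    unfolding SpDr_def mem_Collect_eq
  proof (intro conjI allI impI tp symplectic)
    fix i j k l assume "1 \<le> i \<and> i < j \<and> j < k \<and> k < l \<and> l \<le> 2 * n"
    then have "min_twice (\<mu> (i, j) + \<mu> (k, l)) (\<mu> (i, k) + \<mu> (j, l)) (\<mu> (i, l) + \<mu> (j, k))"
      using pluecker by simp
    then show "let a = \<mu> (i, j) + \<mu> (k, l); b = \<mu> (i, k) + \<mu> (j, l); c = \<mu> (i, l) + \<mu> (j, k);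
        m = min a (min b c) in (a = m \<and> b = m) \<or> (a = m \<and> c = m) \<or> (b = m \<and> c = m)"
      unfolding min_twice_iff Let_def .
  qed
qed

text \<open>\<open>SpDr n\<close> spells out the intersection of the tropical hypersurfaces of the
  relations, so the equation is the tropical basis property. It mentions neither the field nor
  \<open>val\<close>, which gives the independence of \<open>p\<close>.\<close>

theorem theorem4p8:
  fixes val :: "'a::field \<Rightarrow> ereal" and n p :: nat
  assumes "n \<ge> 2"
    and "p = 0 \<or> prime p"
    and "CHAR('a) = p"
    and "alg_closed TYPE('a)"
    and "nonarch_valuation val"
  shows "SpDr n = TSpGr val n"
  using SpDr_subset_TSpGr[OF assms(4,5)] TSpGr_subset_SpDr[OF assms(5)] by (rule antisym)

end
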